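(* In the setting of the context, suppose $Y=\hat Y$, $A=I-K\in S(Y)$ is rich, $\mathcal V$ is sufficient, $\sigma^{\sf op}(K)$ is uniformly Montel on $(Y,s)$, and all the limit operators of $A$ are injective. Then $\sigma^{\sf op}(A)$ is uniformly bounded below. If, moreover, there is an $s$-dense subset of surjective operators in $\sigma^{\sf op}(A)$, then all elements of $\sigma^{\sf op}(A)$ are invertible and their inverses are uniformly bounded.
   Context: $Y$ is a real or complex Banach space, $L(Y)$ the bounded linear operators on $Y$. $\mathcal P=(P_n)_{n=0}^\infty\subset L(Y)$ satisfies: (i) $\sup_n\|P_nx\|=\|x\|$ for all $x\in Y$; (ii) for every $m\in\mathbb N_0$ there is $N(m)\ge m$ with $P_nP_m=P_m=P_mP_n$ for all $n\ge N(m)$. $Q_n:=I-P_n$, $|x|_n:=\max_{0\le m\le n}\|P_mx\|$. The strict topology on $Y$ is generated by the seminorms $|x|_a:=\sup_n a(n)|x|_n$, $a$ running through all positive null sequences; $(Y,s)$ denotes $Y$ with this topology. Strict convergence $x_n\stackrel{s}{\to}x$ holds iff $\sup_n\|x_n\|<\infty$ and $\|P_m(x_n-x)\|\to0$ for every $m$. Let $X$ be the completion of $Y$ with respect to the family of seminorms $\{|\cdot|_n\}$ (to which these seminorms extend) and $\hat Y:=\{x\in X:\sup_n|x|_n<\infty\}$. The condition $Y=\hat Y$ is equivalent to sequential completeness of $(Y,s)$: every norm-bounded sequence $(x_n)\subset Y$ for which $(P_mx_n)_n$ is norm-Cauchy for each $m$ converges strictly to an element of $Y$. $S(Y)$: linear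 operators $A$ on $Y$ with $x_n\stackrel{s}{\to}x\Rightarrow Ax_n\stackrel{s}{\to}Ax$ (automatically $S(Y)\subset L(Y)$). A set $\mathcal K$ of linear operators is uniformly Montel on $(Y,s)$ if $\bigcup_{K\in\mathcal K}K(B)$ is relatively compact in the strict topology for every bounded $B\subset Y$ (equivalently, for all $(K_n)\subset\mathcal K$ and bounded $(x_n)$, $(K_nx_n)$ has a strictly convergent subsequence). For operators, $A_n\stackrel{s}{\to}A$ means: $x_n\stackrel{s}{\to}x\Rightarrow A_nx_n\stackrel{s}{\to}Ax$. A subset $\mathcal A\subset\mathcal K\subset L(Y)$ is $s$-dense in $\mathcal K$ if for every $K\in\mathcal K$ there is $(K_n)\subset\mathcal A$ with $K_n\stackrel{s}{\to}K$. A set $\mathcal A\subset L(Y)$ is uniformly bounded below if there is $\nu>0$ with $\|Ax\|\ge\nu\|x\|$ for all $A\in\mathcal A$, $x\in Y$. $K(Y,\mathcal P):=\{K\in L(Y):\|KQ_n\|\to0,\|Q_nK\|\to0\}$; $A_n\stackrel{\mathcal P}{\to}A$ means $\|(A_n-A)K\|\to0$ and $\|K(A_n-A)\|\to0$ for all $K\in K(Y,\mathcal P)$. For some $N\in\mathbb N$, $\mathcal V=\{V_k\}_{k\in\mathbb Z^N}$ is a group of linear isometries on $Y$ with $V_0=I$, $V_kV_m=V_{k+m}$, such that: for all $m,n\in\mathbb N$ there is $k_0$ with $P_mV_kP_n=0$ if $|k|>k_0$; and for all $m\in\mathbb N$, $k\in\mathbb Z^N$ there is $n_0$ with $P_mV_kQ_n=0=Q_nV_kP_m$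 if $n>n_0$. $\mathcal V$ is sufficient if there is $n\in\mathbb N$ such that for every $x\in Y$ there is $V\in\mathcal V$ with $2|Vx|_n\ge\|x\|$. If $h=(h(n))\subset\mathbb Z^N$, $|h(n)|\to\infty$ and $V_{-h(n)}AV_{h(n)}\stackrel{\mathcal P}{\to}A_h$, then $A_h$ is a limit operator of $A$; $\sigma^{\sf op}(A)$ is the set of all limit operators of $A$. $A$ is rich if every sequence in $\mathbb Z^N$ tending to infinity has a subsequence $g$ for which $A_g$ exists. *)

theory Defs
  imports "HOL-Analysis.Analysis"
begin

text \<open>
  Banach spaces over the real or the complex numbers: the scalars are taken from a type of class
  \<open>real_normed_field\<close>, whose only instances up to isometric isomorphism are the real and the complex
  numbers (Gelfand--Mazur). The \<open>banach\<close> structure of the carrier type supplies the norm and the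
  underlying real space, with which \<open>smul\<close> has to be compatible. For real scalars this forces
  \<open>smul\<close> to be \<open>scaleR\<close>.
\<close>

locale banach_over = vector_space smul
  for smul :: "'k::real_normed_field \<Rightarrow> 'a::banach \<Rightarrow> 'a" +
  assumes scale_of_real: "smul (of_real r) x = r *\<^sub>R x"
    and norm_scale: "norm (smul c x) = norm c * norm x"

definition L_ops :: "('k::real_normed_field \<Rightarrow> 'a::banach \<Rightarrow> 'a) \<Rightarrow> ('a \<Rightarrow> 'a) set" where
  "L_ops smul = {A. Vector_Spaces.linear smul smul A \<and> bounded_linear A}"

definition invertible_in_L :: "('k::real_normed_field \<Rightarrow> 'a::banach \<Rightarrow> 'a) \<Rightarrow> ('a \<Rightarrow> 'a) \<Rightarrow> bool" where
  "invertible_in_L smul A \<longleftrightarrow>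
     A \<in> L_ops smul \<and> (\<exists>B \<in> L_ops smul. A \<circ> B = id \<and> B \<circ> A = id)"

definition uniformly_bounded_below :: "('a::real_normed_vector \<Rightarrow> 'a) set \<Rightarrow> bool" where
  "uniformly_bounded_below \<A> \<longleftrightarrow> (\<exists>\<nu>>0. \<forall>A\<in>\<A>. \<forall>x. norm (A x) \<ge> \<nu> * norm x)"

text \<open>The sequence \<open>\<P>\<close>; boundedness is stated separately because \<open>SUP\<close> is unspecified on
  unbounded sets of reals.\<close>

locale proj_sequence = banach_over smul
  for smul :: "'k::real_normed_field \<Rightarrow> 'a::banach \<Rightarrow> 'a"
  and P :: "nat \<Rightarrow> 'a \<Rightarrow> 'a" +
  assumes P_in_L: "P n \<in> L_ops smul"
    and P_bdd: "bdd_above (range (\<lambda>n. norm (P n x)))"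
    and P_sup: "(SUP n. norm (P n x)) = norm x"
    and P_absorb: "\<exists>N\<ge>m. \<forall>n\<ge>N. P n \<circ> P m = P m \<and> P m = P m \<circ> P n"

definition Q_op :: "(nat \<Rightarrow> 'a::banach \<Rightarrow> 'a) \<Rightarrow> nat \<Rightarrow> 'a \<Rightarrow> 'a" where
  "Q_op P n = (\<lambda>x. x - P n x)"

definition seminorm_n :: "(nat \<Rightarrow> 'a::banach \<Rightarrow> 'a) \<Rightarrow> nat \<Rightarrow> 'a \<Rightarrow> real" where
  "seminorm_n P n x = (MAX m\<in>{..n}. norm (P m x))"

definition positive_null :: "(nat \<Rightarrow> real) \<Rightarrow> bool" where
  "positive_null a \<longleftrightarrow> (\<forall>n. a n > 0) \<and> a \<longlonglongrightarrow> 0"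

definition seminorm_a :: "(nat \<Rightarrow> 'a::banach \<Rightarrow> 'a) \<Rightarrow> (nat \<Rightarrow> real) \<Rightarrow> 'a \<Rightarrow> real" where
  "seminorm_a P a x = (SUP n. a n * seminorm_n P n x)"

definition strict_topology :: "(nat \<Rightarrow> 'a::banach \<Rightarrow> 'a) \<Rightarrow> 'a topology" where
  "strict_topology P =
     topology_generated_by {{y. seminorm_a P a (y - x) < e} | x a e. positive_null a \<and> e > 0}"

definition s_conv :: "(nat \<Rightarrow> 'a::banach \<Rightarrow> 'a) \<Rightarrow> (nat \<Rightarrow> 'a) \<Rightarrow> 'a \<Rightarrow> bool" where
  "s_conv P x l \<longleftrightarrow> limitin (strict_topology P) x l sequentially"

text \<open>
  The completion of \<open>Y\<close> for the countable family of seminorms \<open>seminorm_n P n\<close>: Cauchy sequences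
  modulo null sequences. The seminorms extend to it as limits along representatives.
\<close>

definition sn_Cauchy :: "(nat \<Rightarrow> 'a::banach \<Rightarrow> 'a) \<Rightarrow> (nat \<Rightarrow> 'a) set" where
  "sn_Cauchy P =
     {x. \<forall>n. \<forall>e>0. \<exists>M. \<forall>i\<ge>M. \<forall>j\<ge>M. seminorm_n P n (x i - x j) < e}"

definition sn_equiv :: "(nat \<Rightarrow> 'a::banach \<Rightarrow> 'a) \<Rightarrow> ((nat \<Rightarrow> 'a) \<times> (nat \<Rightarrow> 'a)) set" where
  "sn_equiv P =
     {(x, y). x \<in> sn_Cauchy P \<and> y \<in> sn_Cauchy P \<and> (\<forall>n. (\<lambda>i. seminorm_n P n (x i - y i)) \<longlonglongrightarrow> 0)}"

definition sn_completion :: "(nat \<Rightarrow> 'a::banach \<Rightarrow> 'a) \<Rightarrow> (nat \<Rightarrow> 'a) set set" where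
  "sn_completion P = sn_Cauchy P // sn_equiv P"

definition ext_seminorm_n :: "(nat \<Rightarrow> 'a::banach \<Rightarrow> 'a) \<Rightarrow> nat \<Rightarrow> (nat \<Rightarrow> 'a) set \<Rightarrow> real" where
  "ext_seminorm_n P n \<xi> = (THE r. \<forall>x\<in>\<xi>. (\<lambda>i. seminorm_n P n (x i)) \<longlonglongrightarrow> r)"

definition Y_hat :: "(nat \<Rightarrow> 'a::banach \<Rightarrow> 'a) \<Rightarrow> (nat \<Rightarrow> 'a) set set" where
  "Y_hat P = {\<xi> \<in> sn_completion P. bdd_above (range (\<lambda>n. ext_seminorm_n P n \<xi>))}"

definition completion_embed :: "(nat \<Rightarrow> 'a::banach \<Rightarrow> 'a) \<Rightarrow> 'a \<Rightarrow> (nat \<Rightarrow> 'a) set" where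
  "completion_embed P x = sn_equiv P `` {\<lambda>_. x}"

definition equals_Y_hat :: "(nat \<Rightarrow> 'a::banach \<Rightarrow> 'a) \<Rightarrow> bool" where
  "equals_Y_hat P \<longleftrightarrow> range (completion_embed P) = Y_hat P"

text \<open>Boundedness is not part of the definition of \<open>S(Y)\<close>; it is a consequence.\<close>

definition S_ops :: "('k::real_normed_field \<Rightarrow> 'a::banach \<Rightarrow> 'a) \<Rightarrow> (nat \<Rightarrow> 'a \<Rightarrow> 'a) \<Rightarrow> ('a \<Rightarrow> 'a) set" where
  "S_ops smul P =
     {A. Vector_Spaces.linear smul smul A \<and>
         (\<forall>x l. s_conv P x l \<longrightarrow> s_conv P (\<lambda>n. A (x n)) (A l))}"

definition s_relatively_compact :: "(nat \<Rightarrow> 'a::banach \<Rightarrow> 'a) \<Rightarrow> 'a set \<Rightarrow> bool" where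
  "s_relatively_compact P M \<longleftrightarrow> compactin (strict_topology P) (strict_topology P closure_of M)"

definition uniformly_Montel :: "(nat \<Rightarrow> 'a::banach \<Rightarrow> 'a) \<Rightarrow> ('a \<Rightarrow> 'a) set \<Rightarrow> bool" where
  "uniformly_Montel P \<K> \<longleftrightarrow> (\<forall>B. bounded B \<longrightarrow> s_relatively_compact P (\<Union>K\<in>\<K>. K ` B))"

definition op_s_conv :: "(nat \<Rightarrow> 'a::banach \<Rightarrow> 'a) \<Rightarrow> (nat \<Rightarrow> 'a \<Rightarrow> 'a) \<Rightarrow> ('a \<Rightarrow> 'a) \<Rightarrow> bool" where
  "op_s_conv P A B \<longleftrightarrow> (\<forall>x l. s_conv P x l \<longrightarrow> s_conv P (\<lambda>n. A n (x n)) (B l))"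

definition s_dense_in :: "(nat \<Rightarrow> 'a::banach \<Rightarrow> 'a) \<Rightarrow> ('a \<Rightarrow> 'a) set \<Rightarrow> ('a \<Rightarrow> 'a) set \<Rightarrow> bool" where
  "s_dense_in P \<A> \<K> \<longleftrightarrow>
     \<A> \<subseteq> \<K> \<and> (\<forall>K\<in>\<K>. \<exists>A. (\<forall>n. A n \<in> \<A>) \<and> op_s_conv P A K)"

definition P_compact_ops ::
    "('k::real_normed_field \<Rightarrow> 'a::banach \<Rightarrow> 'a) \<Rightarrow> (nat \<Rightarrow> 'a \<Rightarrow> 'a) \<Rightarrow> ('a \<Rightarrow> 'a) set" where
  "P_compact_ops smul P =
     {K \<in> L_ops smul. (\<lambda>n. onorm (K \<circ> Q_op P n)) \<longlonglongrightarrow> 0 \<and> (\<lambda>n. onorm (Q_op P n \<circ> K)) \<longlonglongrightarrow> 0}"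

definition P_conv ::
    "('k::real_normed_field \<Rightarrow> 'a::banach \<Rightarrow> 'a) \<Rightarrow> (nat \<Rightarrow> 'a \<Rightarrow> 'a) \<Rightarrow> (nat \<Rightarrow> 'a \<Rightarrow> 'a) \<Rightarrow> ('a \<Rightarrow> 'a) \<Rightarrow> bool" where
  "P_conv smul P A B \<longleftrightarrow>
     (\<forall>n. A n \<in> L_ops smul) \<and> B \<in> L_ops smul \<and>
     (\<forall>K \<in> P_compact_ops smul P.
        (\<lambda>n. onorm ((\<lambda>x. A n x - B x) \<circ> K)) \<longlonglongrightarrow> 0 \<and>
        (\<lambda>n. onorm (K \<circ> (\<lambda>x. A n x - B x))) \<longlonglongrightarrow> 0)"

text \<open>\<open>\<int>\<^sup>N\<close> is \<open>int ^ 'n\<close> with \<open>N = CARD('n)\<close>, measured in the maximum norm.\<close>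

definition zabs :: "int ^ 'n \<Rightarrow> int" where
  "zabs k = (MAX i. \<bar>k $ i\<bar>)"

definition tends_to_infinity :: "(nat \<Rightarrow> int ^ 'n) \<Rightarrow> bool" where
  "tends_to_infinity h \<longleftrightarrow> filterlim (\<lambda>n. zabs (h n)) at_top sequentially"

locale isometry_group = proj_sequence smul P
  for smul :: "'k::real_normed_field \<Rightarrow> 'a::banach \<Rightarrow> 'a"
  and P :: "nat \<Rightarrow> 'a \<Rightarrow> 'a" +
  fixes V :: "int ^ 'n \<Rightarrow> 'a \<Rightarrow> 'a"
  assumes V_in_L: "V k \<in> L_ops smul"
    and V_isometry: "norm (V k x) = norm x"
    and V_zero: "V 0 = id"
    and V_add: "V k \<circ> V l = V (k + l)"
    and V_moves: "m \<ge> 1 \<Longrightarrow> n \<ge> 1 \<Longrightarrow> \<exists>k0. \<forall>k. zabs k > k0 \<longrightarrow> P m \<circ> V k \<circ> P n = (\<lambda>x. 0)"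
    and V_local: "m \<ge> 1 \<Longrightarrow> \<exists>n0. \<forall>n>n0. P m \<circ> V k \<circ> Q_op P n = (\<lambda>x. 0) \<and>
                                       Q_op P n \<circ> V k \<circ> P m = (\<lambda>x. 0)"

definition sufficient :: "(nat \<Rightarrow> 'a::banach \<Rightarrow> 'a) \<Rightarrow> (int ^ 'n \<Rightarrow> 'a \<Rightarrow> 'a) \<Rightarrow> bool" where
  "sufficient P V \<longleftrightarrow> (\<exists>n\<ge>1. \<forall>x. \<exists>k. 2 * seminorm_n P n (V k x) \<ge> norm x)"

definition is_limit_op ::
    "('k::real_normed_field \<Rightarrow> 'a::banach \<Rightarrow> 'a) \<Rightarrow> (nat \<Rightarrow> 'a \<Rightarrow> 'a) \<Rightarrow> (int ^ 'n \<Rightarrow> 'a \<Rightarrow> 'a) \<Rightarrow>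
     ('a \<Rightarrow> 'a) \<Rightarrow> (nat \<Rightarrow> int ^ 'n) \<Rightarrow> ('a \<Rightarrow> 'a) \<Rightarrow> bool" where
  "is_limit_op smul P V A h B \<longleftrightarrow>
     tends_to_infinity h \<and> P_conv smul P (\<lambda>n. V (- h n) \<circ> A \<circ> V (h n)) B"

definition op_spectrum ::
    "('k::real_normed_field \<Rightarrow> 'a::banach \<Rightarrow> 'a) \<Rightarrow> (nat \<Rightarrow> 'a \<Rightarrow> 'a) \<Rightarrow> (int ^ 'n \<Rightarrow> 'a \<Rightarrow> 'a) \<Rightarrow>
     ('a \<Rightarrow> 'a) \<Rightarrow> ('a \<Rightarrow> 'a) set" where
  "op_spectrum smul P V A = {B. \<exists>h. is_limit_op smul P V A h B}"

definition rich ::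
    "('k::real_normed_field \<Rightarrow> 'a::banach \<Rightarrow> 'a) \<Rightarrow> (nat \<Rightarrow> 'a \<Rightarrow> 'a) \<Rightarrow> (int ^ 'n \<Rightarrow> 'a \<Rightarrow> 'a) \<Rightarrow>
     ('a \<Rightarrow> 'a) \<Rightarrow> bool" where
  "rich smul P V A \<longleftrightarrow>
     (\<forall>h. tends_to_infinity h \<longrightarrow>
        (\<exists>r. strict_mono r \<and> (\<exists>B. is_limit_op smul P V A (h \<circ> r) B)))"

end

theory Submission
  imports Defs
begin

text \<open>
  The lower bound is a compactness argument. If it fails, there are limit operators \<open>C\<^sub>j\<close> of \<open>A\<close>
  and unit vectors \<open>u\<^sub>j\<close> with \<open>C\<^sub>j u\<^sub>j \<rightarrow> 0\<close>. The set of limit operators is invariant under conjugation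
  with the shifts \<open>V\<^sub>k\<close> (\<open>op_spectrum_shift\<close>), so sufficiency of the group lets us move the mass of
  each \<open>u\<^sub>j\<close> near the origin: \<open>|u\<^sub>j|\<^sub>n \<ge> 1/2\<close> for one fixed \<open>n\<close>. Two compactness
  properties then apply along a common subsequence. Richness of \<open>A\<close> gives \<open>C\<^sub>j \<rightarrow> B\<close>
  for another limit operator \<open>B\<close> (\<open>rich_op_spectrum_seq_compact\<close>, a diagonal argument), and the
  Montel property gives a strict limit \<open>l\<close> of \<open>(I - C\<^sub>j) u\<^sub>j\<close>, because every \<open>I - C\<^sub>j\<close> is a limit
  operator of \<open>K\<close>. Since \<open>C\<^sub>j u\<^sub>j \<rightarrow> 0\<close>, also \<open>u\<^sub>j \<rightarrow> l\<close>, and \<open>l \<noteq> 0\<close> by the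
  normalization. Limit operators of \<open>A \<in> S(Y)\<close> are strictly continuous on bounded sequences
  (\<open>limit_op_coord_continuous\<close>), whence \<open>B l = lim C\<^sub>j u\<^sub>j = 0\<close>, against injectivity of \<open>B\<close>.

  For the second part, let \<open>C\<^sub>n \<rightarrow> B\<close> with surjective \<open>C\<^sub>n\<close>. By the lower bound the solutions
  \<open>x\<^sub>n\<close> of \<open>C\<^sub>n x\<^sub>n = y\<close> are bounded, the Montel property yields a strictly convergent subsequence
  of \<open>(I - C\<^sub>n) x\<^sub>n = x\<^sub>n - y\<close>, and its limit gives a solution of \<open>B x = y\<close>. So \<open>B\<close> is onto, and the lower
  bound \<open>\<nu>\<close> turns into the bound \<open>1 / \<nu>\<close> for the inverse.

  The strict topology is in general not metrizable, so sequences are handled through their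
  coordinates \<open>P\<^sub>m x\<^sub>n\<close>. On norm-bounded sequences convergence of all coordinates is the same as
  strict convergence (\<open>s_conv_imp_coord_conv\<close>, \<open>bounded_coord_conv_imp_s_conv\<close>), and coordinates are
  also where \<open>\<P>\<close>-convergence of operators is felt: it makes each \<open>P\<^sub>m (T\<^sub>n - B)\<close> small in norm.
\<close>

section \<open>Coordinatewise convergence and the strict topology\<close>

definition coord_conv :: "(nat \<Rightarrow> 'a::banach \<Rightarrow> 'a) \<Rightarrow> (nat \<Rightarrow> 'a) \<Rightarrow> 'a \<Rightarrow> bool" where
  "coord_conv P x l \<longleftrightarrow> (\<forall>m. (\<lambda>n. P m (x n)) \<longlonglongrightarrow> P m l)"

lemma coord_conv_subseq:
  "coord_conv P x l \<Longrightarrow> strict_mono r \<Longrightarrow> coord_conv P (x \<circ> r) l"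
  unfolding coord_conv_def using LIMSEQ_subseq_LIMSEQ by (fastforce simp: o_def)

lemma bounded_rangeE:
  fixes x :: "'b \<Rightarrow> 'a::real_normed_vector"
  assumes "bounded (range x)"
  obtains M where "M > 0" "\<And>i. norm (x i) \<le> M"
  using assms by (auto simp: bounded_pos)

context banach_over
begin

lemma L_opsI:
  assumes "\<And>x y. A (x + y) = A x + A y" "\<And>c x. A (smul c x) = smul c (A x)"
    and "\<And>x. norm (A x) \<le> norm x * C"
  shows "A \<in> L_ops smul"
proof -
  have "bounded_linear A"
    using assms(1,3) assms(2)[of "of_real _"] by (intro bounded_linear_intro) (auto simp: scale_of_real)
  moreover have "Vector_Spaces.linear smul smul A"
    using assms(1,2) vector_space_axioms by (simp add: Vector_Spaces.linear_iff)
  ultimately show ?thesis by (simp add: L_ops_def)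
qed

lemma L_ops_bounded_linear: "A \<in> L_ops smul \<Longrightarrow> bounded_linear A"
  by (simp add: L_ops_def)

lemma L_ops_smul: "A \<in> L_ops smul \<Longrightarrow> A (smul c x) = smul c (A x)"
  by (simp add: L_ops_def Vector_Spaces.linear_iff)

lemma L_ops_add: "A \<in> L_ops smul \<Longrightarrow> A (x + y) = A x + A y"
  by (simp add: L_ops_def Vector_Spaces.linear_iff)

lemma L_ops_compose:
  assumes "A \<in> L_ops smul" "B \<in> L_ops smul"
  shows "A \<circ> B \<in> L_ops smul"
proof -
  have "bounded_linear (A \<circ> B)"
    using assms bounded_linear_compose[of A B] by (simp add: L_ops_bounded_linear o_def)
  with assms vector_space_axioms show ?thesis
    by (simp add: L_ops_def Vector_Spaces.linear_iff)
qed

lemma L_ops_diff: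
  assumes "A \<in> L_ops smul" "B \<in> L_ops smul"
  shows "(\<lambda>x. A x - B x) \<in> L_ops smul"
proof -
  have "bounded_linear (\<lambda>x. A x - B x)"
    using assms by (simp add: L_ops_bounded_linear bounded_linear_sub)
  with assms vector_space_axioms show ?thesis
    by (simp add: L_ops_def Vector_Spaces.linear_iff scale_right_diff_distrib)
qed

lemma id_L_ops: "(\<lambda>x. x) \<in> L_ops smul"
  by (rule L_opsI[where C = 1]) auto

end

context proj_sequence
begin

lemma P_bounded_linear: "bounded_linear (P m)"
  using P_in_L by (rule L_ops_bounded_linear)

lemma P_add: "P m (x + y) = P m x + P m y"
  using P_in_L by (rule L_ops_add)

lemma P_diff: "P m (x - y) = P m x - P m y"
  using P_bounded_linear by (simp add: linear_diff bounded_linear.linear)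

lemma norm_P_le: "norm (P m x) \<le> norm x"
  using cSUP_upper[of m UNIV "\<lambda>n. norm (P n x)"] P_bdd[of x] P_sup[of x] by simp

lemma norm_le_coords: "(\<And>m. norm (P m x) \<le> c) \<Longrightarrow> norm x \<le> c"
  using cSUP_least[of UNIV "\<lambda>n. norm (P n x)" c] by (simp add: P_sup)

text \<open>
  A vector with vanishing coordinates is zero because the coordinates compute the norm; hence
  coordinatewise limits are unique.
\<close>

lemma P_separates: "(\<And>m. P m x = P m y) \<Longrightarrow> x = y"
  using norm_le_coords[of "x - y" 0] by (simp add: P_diff)

lemma P_absorb_eventually: "eventually (\<lambda>n. P n \<circ> P m = P m \<and> P m \<circ> P n = P m) sequentially"
  using P_absorb[of m] unfolding eventually_sequentially by metis

lemma coord_conv_unique: "coord_conv P x l \<Longrightarrow> coord_conv P x l' \<Longrightarrow> l = l'"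
  unfolding coord_conv_def by (rule P_separates) (metis LIMSEQ_unique)

lemma norm_P_le_seminorm: "m \<le> n \<Longrightarrow> norm (P m x) \<le> seminorm_n P n x"
  unfolding seminorm_n_def by (intro Max_ge) auto

lemma seminorm_n_le_iff: "seminorm_n P n x \<le> c \<longleftrightarrow> (\<forall>m\<le>n. norm (P m x) \<le> c)"
  unfolding seminorm_n_def by (subst Max_le_iff) auto

lemma seminorm_n_le_norm: "seminorm_n P n x \<le> norm x"
  by (simp add: seminorm_n_le_iff norm_P_le)

lemma seminorm_n_nonneg: "0 \<le> seminorm_n P n x"
  using norm_P_le_seminorm[of n n x] norm_ge_zero order_trans by blast

lemma seminorm_n_zero: "seminorm_n P n 0 = 0"
  using seminorm_n_nonneg[of n 0] seminorm_n_le_norm[of n 0] by simp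

lemma seminorm_n_triangle: "seminorm_n P n (x + y) \<le> seminorm_n P n x + seminorm_n P n y"
  unfolding seminorm_n_le_iff
  by (metis P_add add_mono norm_P_le_seminorm norm_triangle_ineq order_trans)

lemma seminorm_n_coord_conv:
  assumes "coord_conv P x l"
  shows "(\<lambda>i. seminorm_n P n (x i - l)) \<longlonglongrightarrow> 0"
proof (rule tendsto_sandwich[of "\<lambda>_. 0" _ _ "\<lambda>i. \<Sum>m\<le>n. norm (P m (x i) - P m l)"])
  show "(\<lambda>i. \<Sum>m\<le>n. norm (P m (x i) - P m l)) \<longlonglongrightarrow> 0"
    using assms unfolding coord_conv_def
    by (intro tendsto_null_sum tendsto_norm_zero) (simp add: LIM_zero)
  have "seminorm_n P n (x i - l) \<le> (\<Sum>m\<le>n. norm (P m (x i) - P m l))" for i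
    unfolding seminorm_n_le_iff P_diff
    using member_le_sum[of _ "{..n}" "\<lambda>m. norm (P m (x i) - P m l)"] by auto
  then show "\<forall>\<^sub>F i in sequentially. seminorm_n P n (x i - l) \<le> (\<Sum>m\<le>n. norm (P m (x i) - P m l))"
    by simp
qed (auto simp: seminorm_n_nonneg)

lemma positive_null_bounded:
  assumes "positive_null a"
  obtains C where "C > 0" "\<And>n. a n \<le> C"
  using assms convergent_imp_Bseq[of a] unfolding positive_null_def Bseq_def convergent_def
  by (metis abs_of_pos real_norm_def)

lemma seminorm_a_bdd:
  assumes "positive_null a"
  shows "bdd_above (range (\<lambda>n. a n * seminorm_n P n x))"
proof -
  obtain C where "C > 0" "\<And>n. a n \<le> C" using positive_null_bounded[OF assms] by blast
  then have "a n * seminorm_n P n x \<le> C * norm x" for n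
    using seminorm_n_le_norm seminorm_n_nonneg by (intro mult_mono) auto
  then show ?thesis by (intro bdd_aboveI) auto
qed

lemma seminorm_a_upper: "positive_null a \<Longrightarrow> a n * seminorm_n P n x \<le> seminorm_a P a x"
  unfolding seminorm_a_def by (intro cSUP_upper seminorm_a_bdd) auto

lemma seminorm_a_least: "(\<And>n. a n * seminorm_n P n x \<le> c) \<Longrightarrow> seminorm_a P a x \<le> c"
  unfolding seminorm_a_def by (intro cSUP_least) auto

lemma seminorm_a_triangle:
  assumes "positive_null a"
  shows "seminorm_a P a (x + y) \<le> seminorm_a P a x + seminorm_a P a y"
proof (rule seminorm_a_least)
  fix n
  have "a n > 0" using assms by (simp add: positive_null_def)
  then have "a n * seminorm_n P n (x + y) \<le> a n * seminorm_n P n x + a n * seminorm_n P n y"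
    using seminorm_n_triangle[of n x y] by (simp flip: distrib_left)
  with seminorm_a_upper[OF assms] show "a n * seminorm_n P n (x + y) \<le> seminorm_a P a x + seminorm_a P a y"
    by (smt (verit))
qed

lemma openin_strict_ball:
  "positive_null a \<Longrightarrow> e > 0 \<Longrightarrow> openin (strict_topology P) {y. seminorm_a P a (y - x) < e}"
  unfolding strict_topology_def by (rule topology_generated_by_Basis) blast

lemma harmonic_positive_null: "positive_null (\<lambda>n. 1 / real (Suc n))"
  unfolding positive_null_def using lim_inverse_n' LIMSEQ_Suc[of "\<lambda>n. 1 / real n"] by auto

text \<open>
  The weight \<open>a(n) = 1/(n+1)\<close> shows that each \<open>|\<cdot>|\<^sub>m\<close> is dominated by a strict seminorm,
  \<open>|\<cdot>|\<^sub>m \<le> (m+1) |\<cdot>|\<^sub>a\<close>.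
\<close>

lemma strict_nhd:
  assumes "e > 0"
  obtains U where "openin (strict_topology P) U" "l \<in> U" "\<And>y. y \<in> U \<Longrightarrow> seminorm_n P m (y - l) < e"
proof
  let ?a = "\<lambda>n. 1 / real (Suc n)"
  let ?U = "{y. seminorm_a P ?a (y - l) < e / real (Suc m)}"
  show "openin (strict_topology P) ?U"
    using assms by (intro openin_strict_ball harmonic_positive_null) auto
  have "seminorm_a P ?a 0 \<le> 0" by (rule seminorm_a_least) (simp add: seminorm_n_zero)
  then show "l \<in> ?U" using assms by (simp add: order_le_less_trans)
  fix y assume "y \<in> ?U"
  then have "?a m * seminorm_n P m (y - l) < e / real (Suc m)"
    using seminorm_a_upper[OF harmonic_positive_null, of m "y - l"] by simp
  then show "seminorm_n P m (y - l) < e" by (simp add: divide_less_cancel)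
qed

lemma topspace_strict: "topspace (strict_topology P) = UNIV"
  using strict_nhd[of 1] openin_subset by (metis UNIV_eq_I subsetD zero_less_one)

lemma s_conv_imp_coord_conv:
  assumes "s_conv P x l"
  shows "coord_conv P x l"
  unfolding coord_conv_def
proof (intro allI LIMSEQ_I)
  fix m and e :: real assume "e > 0"
  then obtain U where U: "openin (strict_topology P) U" "l \<in> U"
    "\<And>y. y \<in> U \<Longrightarrow> seminorm_n P m (y - l) < e" using strict_nhd by metis
  then have "eventually (\<lambda>n. x n \<in> U) sequentially"
    using assms unfolding s_conv_def limitin_def by blast
  then have "eventually (\<lambda>n. norm (P m (x n) - P m l) < e) sequentially"
  proof eventually_elim
    case (elim n)
    then show ?case using U(3) norm_P_le_seminorm[of m m "x n - l"] by (force simp: P_diff)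
  qed
  then show "\<exists>no. \<forall>n\<ge>no. norm (P m (x n) - P m l) < e" by (simp add: eventually_sequentially)
qed

lemma seminorm_a_coord_conv:
  assumes a: "positive_null a" and bdd: "bounded (range x)" and conv: "coord_conv P x l" and "e > 0"
  shows "eventually (\<lambda>i. seminorm_a P a (x i - l) < e) sequentially"
proof -
  obtain C where C: "C > 0" "\<And>n. a n \<le> C" using positive_null_bounded[OF a] by blast
  obtain M where M: "M > 0" "\<And>i. norm (x i) \<le> M" using bdd bounded_rangeE by blast
  define R where "R = M + norm l"
  have R: "R > 0" "norm (x i - l) \<le> R" for i
    using M norm_triangle_ineq4[of "x i" l] by (auto simp: R_def add_pos_nonneg intro: order_trans)
  \<comment> \<open>Beyond \<open>N\<close> the weights are so small that the norm bound suffices; up to \<open>N\<close> one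
    seminorm dominates.\<close>
  have "a \<longlonglongrightarrow> 0" "e / (2 * R) > 0" using a R \<open>e > 0\<close> by (auto simp: positive_null_def)
  then obtain N where N: "\<And>n. n \<ge> N \<Longrightarrow> a n < e / (2 * R)"
    using order_tendstoD(2)[of a 0 sequentially "e / (2 * R)"] by (auto simp: eventually_sequentially)
  have "eventually (\<lambda>i. seminorm_n P N (x i - l) < e / (2 * C)) sequentially"
    using order_tendstoD(2)[OF seminorm_n_coord_conv[OF conv]] \<open>e > 0\<close> C by simp
  then show ?thesis
  proof eventually_elim
    case (elim i)
    have "a n * seminorm_n P n (x i - l) \<le> e / 2" for n
    proof (cases "n \<le> N")
      case True
      then have "seminorm_n P n (x i - l) \<le> seminorm_n P N (x i - l)"
        by (simp add: seminorm_n_le_iff norm_P_le_seminorm)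
      then have "a n * seminorm_n P n (x i - l) \<le> C * (e / (2 * C))"
        using elim C seminorm_n_nonneg by (intro mult_mono) auto
      then show ?thesis using C by simp
    next
      case False
      then have "a n * seminorm_n P n (x i - l) \<le> e / (2 * R) * R"
        using N[of n] R(2)[of i] seminorm_n_le_norm[of n "x i - l"] seminorm_n_nonneg \<open>e > 0\<close> R(1)
        by (intro mult_mono) auto
      then show ?thesis using R(1) by simp
    qed
    then have "seminorm_a P a (x i - l) \<le> e / 2" by (rule seminorm_a_least)
    then show ?case using \<open>e > 0\<close> by simp
  qed
qed

text \<open>
  The strict topology is given by a subbase only, and its balls have arbitrary centres; eventual
  membership in neighbourhoods of \<open>l\<close> passes through the generation of open sets, and for a ball the
  triangle inequality moves the centre to \<open>l\<close>.
\<close>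

lemma bounded_coord_conv_imp_s_conv:
  assumes bdd: "bounded (range x)" and conv: "coord_conv P x l"
  shows "s_conv P x l"
proof -
  let ?S = "{{y. seminorm_a P a (y - c) < e} | c a e. positive_null a \<and> e > 0}"
  have "generate_topology_on ?S U \<Longrightarrow> l \<in> U \<longrightarrow> eventually (\<lambda>n. x n \<in> U) sequentially" for U
  proof (induction rule: generate_topology_on.induct)
    case (Int U W)
    then show ?case by (simp add: eventually_conj_iff)
  next
    case (UN \<U>)
    show ?case
    proof
      assume "l \<in> \<Union>\<U>"
      then obtain W where W: "W \<in> \<U>" "l \<in> W" by blast
      with UN have "eventually (\<lambda>n. x n \<in> W) sequentially" by blast
      then show "eventually (\<lambda>n. x n \<in> \<Union>\<U>) sequentially"
        by eventually_elim (use W in blast)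
    qed
  next
    case (Basis U)
    then obtain c a e where U: "U = {y. seminorm_a P a (y - c) < e}" "positive_null a" "e > 0" by blast
    show ?case
    proof
      assume "l \<in> U"
      then have "e - seminorm_a P a (l - c) > 0" using U by simp
      from seminorm_a_coord_conv[OF U(2) bdd conv this]
      show "eventually (\<lambda>n. x n \<in> U) sequentially"
      proof eventually_elim
        case (elim n)
        then show ?case using seminorm_a_triangle[OF U(2), of "x n - l" "l - c"] U(1) by simp
      qed
    qed
  qed auto
  then show ?thesis
    unfolding s_conv_def limitin_def
    by (simp add: topspace_strict) (simp add: strict_topology_def openin_topology_generated_by_iff)
qed

text \<open>
  Compactness gives a cluster point of the sequence. The neighbourhoods \<open>{z. |z - l|\<^sub>i < 1/(i+1)}\<close>
  are countably many and suffice for coordinatewise convergence, so a subsequence converges in that sense even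
  though the strict topology itself may lack countable neighbourhood bases.
\<close>

lemma s_relatively_compact_subseq:
  assumes M: "s_relatively_compact P M" and y: "\<And>j. y j \<in> M"
  obtains r l where "strict_mono (r :: nat \<Rightarrow> nat)" "coord_conv P (y \<circ> r) l"
proof -
  let ?C = "strict_topology P closure_of M"
  have comp: "compactin (strict_topology P) ?C" using M by (simp add: s_relatively_compact_def)
  have yC: "y j \<in> ?C" for j using y closure_of_subset[of M "strict_topology P"] by (auto simp: topspace_strict)
  \<comment> \<open>Otherwise finitely many open sets, each visited finitely often, would cover the sequence.\<close>
  have "\<exists>l\<in>?C. \<forall>U. openin (strict_topology P) U \<and> l \<in> U \<longrightarrow> infinite {j. y j \<in> U}"
  proof (rule ccontr)
    assume "\<not> ?thesis"
    then obtain U where U: "\<And>l. l \<in> ?C \<Longrightarrow> openin (strict_topology P) (U l) \<and> l \<in> U l \<and> finite {j. y j \<in> U l}"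
      by metis
    then have "Ball (U ` ?C) (openin (strict_topology P))" "?C \<subseteq> \<Union>(U ` ?C)" by auto
    then obtain \<F> where F: "finite \<F>" "\<F> \<subseteq> U ` ?C" "?C \<subseteq> \<Union>\<F>"
      using comp unfolding compactin_def by meson
    have "UNIV \<subseteq> (\<Union>W\<in>\<F>. {j. y j \<in> W})" using yC F(3) by blast
    moreover have "finite (\<Union>W\<in>\<F>. {j. y j \<in> W})" using F(1,2) U by (intro finite_UN_I) auto
    ultimately show False using infinite_UNIV_nat finite_subset by blast
  qed
  then obtain l where l: "\<And>U. openin (strict_topology P) U \<Longrightarrow> l \<in> U \<Longrightarrow> infinite {j. y j \<in> U}" by blast
  have ex: "\<exists>j>N. seminorm_n P i (y j - l) < 1 / real (Suc i)" for i N
  proof -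
    obtain U where U: "openin (strict_topology P) U" "l \<in> U"
      "\<And>y. y \<in> U \<Longrightarrow> seminorm_n P i (y - l) < 1 / real (Suc i)"
      using strict_nhd[of "1 / real (Suc i)"] by auto
    from l[OF U(1,2)] show ?thesis using U(3) unfolding infinite_nat_iff_unbounded by blast
  qed
  obtain r where r: "\<And>i. seminorm_n P i (y (r i) - l) < 1 / real (Suc i)" "\<And>i. r i < r (Suc i)"
    using dependent_nat_choice[of "\<lambda>i j. seminorm_n P i (y j - l) < 1 / real (Suc i)" "\<lambda>i j j'. j < j'"] ex
    by metis
  have "coord_conv P (y \<circ> r) l"
    unfolding coord_conv_def
  proof
    fix m
    have "eventually (\<lambda>i. norm (P m ((y \<circ> r) i) - P m l) \<le> 1 / real (Suc i)) sequentially"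
      using eventually_ge_at_top[of m]
    proof eventually_elim
      case (elim i)
      then show ?case using norm_P_le_seminorm[of m i "y (r i) - l"] r(1)[of i] by (simp add: P_diff)
    qed
    then have "(\<lambda>i. P m ((y \<circ> r) i) - P m l) \<longlonglongrightarrow> 0"
      by (rule Lim_null_comparison) (use harmonic_positive_null in \<open>simp add: positive_null_def\<close>)
    then show "(\<lambda>i. P m ((y \<circ> r) i)) \<longlonglongrightarrow> P m l" by (rule LIM_zero_cancel)
  qed
  moreover have "strict_mono r" using r(2) by (simp add: strict_mono_Suc_iff)
  ultimately show thesis using that by blast
qed

lemma uniformly_Montel_subseq:
  assumes "uniformly_Montel P \<K>" "\<And>j. K j \<in> \<K>" "bounded (range x)"
  obtains r l where "strict_mono (r :: nat \<Rightarrow> nat)" "coord_conv P ((\<lambda>j. K j (x j)) \<circ> r) l"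
proof (rule s_relatively_compact_subseq)
  show "s_relatively_compact P (\<Union>K\<in>\<K>. K ` range x)"
    using assms(1,3) unfolding uniformly_Montel_def by blast
  show "K j (x j) \<in> (\<Union>K\<in>\<K>. K ` range x)" for j using assms(2) by blast
qed (rule that)

section \<open>Operators that are \<open>\<P>\<close>-compact, and \<open>\<P>\<close>-convergence\<close>

lemma Q_in_L: "Q_op P n \<in> L_ops smul"
  unfolding Q_op_def by (intro L_ops_diff id_L_ops P_in_L)

lemma norm_Q_le: "norm (Q_op P n x) \<le> 2 * norm x"
  using norm_triangle_ineq4[of x "P n x"] norm_P_le[of n x] by (simp add: Q_op_def)

text \<open>
  Eventually \<open>P\<^sub>m Q\<^sub>n = 0 = Q\<^sub>n P\<^sub>m\<close>, so each \<open>P\<^sub>m\<close> may be used as a test operator for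
  \<open>\<P>\<close>-convergence.
\<close>

lemma P_in_P_compact: "P m \<in> P_compact_ops smul P"
proof -
  have "eventually (\<lambda>n. onorm (P m \<circ> Q_op P n) = 0 \<and> onorm (Q_op P n \<circ> P m) = 0) sequentially"
    using P_absorb_eventually[of m]
  proof eventually_elim
    case (elim n)
    then have "P n (P m x) = P m x \<and> P m (P n x) = P m x" for x by (metis comp_apply)
    then show ?case by (simp add: o_def Q_op_def P_diff onorm_zero)
  qed
  then show ?thesis
    using P_in_L tendsto_eventually[of "\<lambda>n. onorm (P m \<circ> Q_op P n)"]
      tendsto_eventually[of "\<lambda>n. onorm (Q_op P n \<circ> P m)"]
    by (auto simp: P_compact_ops_def eventually_conj_iff)
qed

lemma P_conv_coord:
  assumes "P_conv smul P T B"
  shows "(\<lambda>n. onorm (P m \<circ> (\<lambda>x. T n x - B x))) \<longlonglongrightarrow> 0"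
  using assms P_in_P_compact unfolding P_conv_def by blast

lemma norm_P_op_diff_le:
  assumes "S \<in> L_ops smul" "T \<in> L_ops smul"
  shows "norm (P m (S x) - P m (T x)) \<le> onorm (P m \<circ> (\<lambda>x. S x - T x)) * norm x"
  using onorm[OF L_ops_bounded_linear[OF L_ops_compose[OF P_in_L L_ops_diff[OF assms]]], of m x]
  by (simp add: P_diff)

text \<open>
  On a bounded sequence \<open>T\<^sub>n\<close> may be replaced by its limit \<open>B\<close>, at the cost of a null sequence in each
  coordinate.
\<close>

lemma coord_conv_op_limit:
  assumes T: "\<And>n. T n \<in> L_ops smul" and B: "B \<in> L_ops smul"
    and conv: "\<And>m. (\<lambda>n. onorm (P m \<circ> (\<lambda>x. T n x - B x))) \<longlonglongrightarrow> 0"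
    and bdd: "bounded (range x)"
    and TC: "coord_conv P (\<lambda>n. B (x n)) l"
  shows "coord_conv P (\<lambda>n. T n (x n)) l"
  unfolding coord_conv_def
proof
  fix m
  obtain M where M: "\<And>i. norm (x i) \<le> M" using bdd bounded_rangeE by blast
  have "norm (P m (T n (x n)) - P m (B (x n))) \<le> onorm (P m \<circ> (\<lambda>x. T n x - B x)) * M" for n
  proof -
    have "0 \<le> onorm (P m \<circ> (\<lambda>x. T n x - B x))"
      using onorm_pos_le L_ops_bounded_linear L_ops_compose L_ops_diff P_in_L T B by metis
    with norm_P_op_diff_le[OF T B] M show ?thesis
      by (meson mult_left_mono order_trans)
  qed
  moreover have "(\<lambda>n. onorm (P m \<circ> (\<lambda>x. T n x - B x)) * M) \<longlonglongrightarrow> 0"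
    using conv by (rule tendsto_mult_left_zero)
  ultimately have "(\<lambda>n. P m (T n (x n)) - P m (B (x n))) \<longlonglongrightarrow> 0"
    by (rule Lim_null_comparison[OF always_eventually[OF allI]])
  moreover have "(\<lambda>n. P m (B (x n))) \<longlonglongrightarrow> P m l" using TC by (simp add: coord_conv_def)
  ultimately have "(\<lambda>n. (P m (T n (x n)) - P m (B (x n))) + P m (B (x n))) \<longlonglongrightarrow> 0 + P m l"
    by (rule tendsto_add)
  then show "(\<lambda>n. P m (T n (x n))) \<longlonglongrightarrow> P m l" by simp
qed

end

section \<open>Shifts and limit operators\<close>

text \<open>
  The form in which smallness of \<open>f\<close> is usually obtained below: for each cut-off \<open>m\<close> the part of an
  operator inside \<open>P\<^sub>m\<close> vanishes for large \<open>n\<close>, and the part outside is bounded by \<open>C * g m\<close>.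
\<close>

lemma null_if_eventually_le:
  fixes f g :: "nat \<Rightarrow> real"
  assumes "\<And>n. 0 \<le> f n" "\<And>m. eventually (\<lambda>n. f n \<le> C * g m) sequentially" "g \<longlonglongrightarrow> 0"
  shows "f \<longlonglongrightarrow> 0"
proof (rule LIMSEQ_I)
  fix e :: real assume "e > 0"
  have "(\<lambda>m. C * g m) \<longlonglongrightarrow> 0" using assms(3) by (rule tendsto_mult_right_zero)
  then have "eventually (\<lambda>m. C * g m < e) sequentially" using \<open>e > 0\<close> by (rule order_tendstoD)
  then obtain m where "C * g m < e" by (auto simp: eventually_sequentially)
  with assms(2)[of m] show "\<exists>no. \<forall>n\<ge>no. norm (f n - 0) < e"
    using assms(1) by (fastforce simp: eventually_sequentially)
qed

lemma zabs_triangle: "zabs (k + l) \<le> zabs k + zabs (l :: int ^ 'n)"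
proof -
  have "\<bar>k $ i\<bar> \<le> zabs k" "\<bar>l $ i\<bar> \<le> zabs l" for i
    unfolding zabs_def by (auto intro: Max_ge)
  then have "\<bar>(k + l) $ i\<bar> \<le> zabs k + zabs l" for i
    by (smt (verit) vector_add_component)
  then show ?thesis unfolding zabs_def[of "k + l"] by (intro Max.boundedI) auto
qed

lemma zabs_minus: "zabs (- k) = zabs (k :: int ^ 'n)"
  by (simp add: zabs_def)

lemma tends_to_infinity_add:
  assumes "tends_to_infinity h"
  shows "tends_to_infinity (\<lambda>n. h n + k)"
  unfolding tends_to_infinity_def filterlim_at_top
proof
  fix z
  have "eventually (\<lambda>n. z + zabs k \<le> zabs (h n)) sequentially"
    using assms by (simp add: tends_to_infinity_def filterlim_at_top)
  then show "eventually (\<lambda>n. z \<le> zabs (h n + k)) sequentially"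
  proof eventually_elim
    case (elim n)
    then show ?case using zabs_triangle[of "h n + k" "- k"] by (simp add: zabs_minus)
  qed
qed

context isometry_group
begin

lemma V_bounded_linear: "bounded_linear (V k)"
  using V_in_L by (rule L_ops_bounded_linear)

lemma V_inverse [simp]: "V (- k) (V k x) = x" "V k (V (- k) x) = x"
  using V_add[of "- k" k] V_add[of k "- k"] by (simp_all add: V_zero fun_eq_iff)

lemma onorm_V_left: "onorm (V k \<circ> T) = onorm T"
  by (simp add: onorm_def V_isometry)

lemma onorm_V_right_le: "bounded_linear T \<Longrightarrow> onorm (T \<circ> V k) \<le> onorm T"
  by (rule onorm_bound) (metis onorm_pos_le, metis comp_apply onorm V_isometry)

text \<open>
  Locality of the shifts is postulated for \<open>m \<ge> 1\<close>; the case \<open>m = 0\<close> follows because \<open>P\<^sub>m\<close> factors through some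
  \<open>P\<^sub>m\<^sub>'\<close> with \<open>m' \<ge> 1\<close> on either side.
\<close>

lemma V_local_all:
  obtains n0 where "\<And>n x. n > n0 \<Longrightarrow> P m (V k (Q_op P n x)) = 0"
    "\<And>n x. n > n0 \<Longrightarrow> Q_op P n (V k (P m x)) = 0"
proof -
  have "eventually (\<lambda>n. n \<ge> 1 \<and> P n \<circ> P m = P m \<and> P m \<circ> P n = P m) sequentially"
    using P_absorb_eventually[of m] eventually_ge_at_top[of 1] by eventually_elim simp
  then obtain m' where m': "m' \<ge> 1" "\<And>x. P m' (P m x) = P m x" "\<And>x. P m (P m' x) = P m x"
    by (auto simp: eventually_sequentially fun_eq_iff)
  obtain n0 where n0: "\<And>n. n > n0 \<Longrightarrow> P m' \<circ> V k \<circ> Q_op P n = (\<lambda>x. 0) \<and> Q_op P n \<circ> V k \<circ> P m' = (\<lambda>x. 0)"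
    using V_local[OF m'(1)] by blast
  have "P m (V k (Q_op P n x)) = 0" if "n > n0" for n x
    using n0[OF that] m'(3)[of "V k (Q_op P n x)"] P_diff[of m 0 0] by (simp add: fun_eq_iff)
  moreover have "Q_op P n (V k (P m x)) = 0" if "n > n0" for n x
    using n0[OF that] m'(2)[of x] by (simp add: fun_eq_iff) metis
  ultimately show thesis using that by blast
qed

text \<open>
  Multiplication by a shift on either side preserves \<open>K(Y, \<P>)\<close>. For \<open>Q\<^sub>n V\<^sub>k K\<close> split
  \<open>K = P\<^sub>m K + Q\<^sub>m K\<close>: the first part is annihilated by locality for large \<open>n\<close>, the second is uniformly small.
\<close>

lemma V_left_P_compact:
  assumes K: "K \<in> P_compact_ops smul P"
  shows "V k \<circ> K \<in> P_compact_ops smul P"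
proof -
  have KL: "K \<in> L_ops smul" and K1: "(\<lambda>n. onorm (K \<circ> Q_op P n)) \<longlonglongrightarrow> 0"
    and K2: "(\<lambda>n. onorm (Q_op P n \<circ> K)) \<longlonglongrightarrow> 0"
    using K by (auto simp: P_compact_ops_def)
  have VK: "V k \<circ> K \<in> L_ops smul" by (intro L_ops_compose V_in_L KL)
  have "(\<lambda>n. onorm (Q_op P n \<circ> (V k \<circ> K))) \<longlonglongrightarrow> 0"
  proof (rule null_if_eventually_le[OF _ _ K2])
    show "0 \<le> onorm (Q_op P n \<circ> (V k \<circ> K))" for n
      by (intro onorm_pos_le L_ops_bounded_linear L_ops_compose[OF Q_in_L VK])
    fix m
    obtain n0 where n0: "\<And>n x. n > n0 \<Longrightarrow> Q_op P n (V k (P m x)) = 0" using V_local_all by metis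
    have "onorm (Q_op P n \<circ> (V k \<circ> K)) \<le> 2 * onorm (Q_op P m \<circ> K)" if "n > n0" for n
    proof (rule onorm_bound)
      show "0 \<le> 2 * onorm (Q_op P m \<circ> K)"
        using onorm_pos_le[OF L_ops_bounded_linear[OF L_ops_compose[OF Q_in_L KL]], of m] by simp
      fix x
      have "V k (K x) = V k (P m (K x)) + V k (Q_op P m (K x))"
        using L_ops_add[OF V_in_L, of k "P m (K x)" "Q_op P m (K x)"] by (simp add: Q_op_def)
      then have "(Q_op P n \<circ> (V k \<circ> K)) x = Q_op P n (V k (Q_op P m (K x)))"
        using n0[OF that] L_ops_add[OF Q_in_L] by simp
      then have "norm ((Q_op P n \<circ> (V k \<circ> K)) x) \<le> 2 * norm ((Q_op P m \<circ> K) x)"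
        using norm_Q_le by (metis V_isometry comp_apply)
      also have "\<dots> \<le> 2 * (onorm (Q_op P m \<circ> K) * norm x)"
        by (intro mult_left_mono onorm L_ops_bounded_linear L_ops_compose Q_in_L KL) auto
      finally show "norm ((Q_op P n \<circ> (V k \<circ> K)) x) \<le> 2 * onorm (Q_op P m \<circ> K) * norm x" by simp
    qed
    then show "eventually (\<lambda>n. onorm (Q_op P n \<circ> (V k \<circ> K)) \<le> 2 * onorm (Q_op P m \<circ> K)) sequentially"
      by (intro eventually_mono[OF eventually_gt_at_top[of n0]])
  qed
  then show ?thesis using VK K1 by (simp add: P_compact_ops_def comp_assoc onorm_V_left)
qed

lemma V_right_P_compact:
  assumes K: "K \<in> P_compact_ops smul P"
  shows "K \<circ> V k \<in> P_compact_ops smul P"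
proof -
  have KL: "K \<in> L_ops smul" and K1: "(\<lambda>n. onorm (K \<circ> Q_op P n)) \<longlonglongrightarrow> 0"
    and K2: "(\<lambda>n. onorm (Q_op P n \<circ> K)) \<longlonglongrightarrow> 0"
    using K by (auto simp: P_compact_ops_def)
  have KV: "K \<circ> V k \<in> L_ops smul" by (intro L_ops_compose V_in_L KL)
  have "(\<lambda>n. onorm ((K \<circ> V k) \<circ> Q_op P n)) \<longlonglongrightarrow> 0"
  proof (rule null_if_eventually_le[OF _ _ K1])
    show "0 \<le> onorm ((K \<circ> V k) \<circ> Q_op P n)" for n
      by (intro onorm_pos_le L_ops_bounded_linear L_ops_compose[OF KV Q_in_L])
    fix m
    obtain n0 where n0: "\<And>n x. n > n0 \<Longrightarrow> P m (V k (Q_op P n x)) = 0" using V_local_all by metis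
    have "onorm ((K \<circ> V k) \<circ> Q_op P n) \<le> 2 * onorm (K \<circ> Q_op P m)" if "n > n0" for n
    proof (rule onorm_bound)
      show "0 \<le> 2 * onorm (K \<circ> Q_op P m)"
        using onorm_pos_le[OF L_ops_bounded_linear[OF L_ops_compose[OF KL Q_in_L]], of m] by simp
      fix x
      let ?y = "V k (Q_op P n x)"
      have "Q_op P m ?y = ?y" using n0[OF that] by (simp add: Q_op_def)
      then have "norm (((K \<circ> V k) \<circ> Q_op P n) x) = norm ((K \<circ> Q_op P m) ?y)" by simp
      also have "\<dots> \<le> onorm (K \<circ> Q_op P m) * norm ?y"
        by (intro onorm L_ops_bounded_linear L_ops_compose Q_in_L KL)
      also have "\<dots> \<le> onorm (K \<circ> Q_op P m) * (2 * norm x)"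
        unfolding V_isometry
        by (intro mult_left_mono norm_Q_le onorm_pos_le L_ops_bounded_linear L_ops_compose Q_in_L KL)
      finally show "norm (((K \<circ> V k) \<circ> Q_op P n) x) \<le> 2 * onorm (K \<circ> Q_op P m) * norm x"
        by (simp add: mult_ac)
    qed
    then show "eventually (\<lambda>n. onorm ((K \<circ> V k) \<circ> Q_op P n) \<le> 2 * onorm (K \<circ> Q_op P m)) sequentially"
      by (intro eventually_mono[OF eventually_gt_at_top[of n0]])
  qed
  moreover have "(\<lambda>n. onorm (Q_op P n \<circ> (K \<circ> V k))) \<longlonglongrightarrow> 0"
  proof (rule tendsto_sandwich[OF _ _ tendsto_const K2])
    show "\<forall>\<^sub>F n in sequentially. 0 \<le> onorm (Q_op P n \<circ> (K \<circ> V k))"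
      by (intro always_eventually allI onorm_pos_le L_ops_bounded_linear L_ops_compose[OF Q_in_L KV])
    show "\<forall>\<^sub>F n in sequentially. onorm (Q_op P n \<circ> (K \<circ> V k)) \<le> onorm (Q_op P n \<circ> K)"
      unfolding comp_assoc[symmetric]
      by (intro always_eventually allI onorm_V_right_le L_ops_bounded_linear L_ops_compose[OF Q_in_L KL])
  qed
  ultimately show ?thesis using KV by (simp add: P_compact_ops_def)
qed

lemma op_spectrumE:
  assumes "B \<in> op_spectrum smul P V A"
  obtains h where "tends_to_infinity h" "P_conv smul P (\<lambda>n. V (- h n) \<circ> A \<circ> V (h n)) B"
  using assms by (auto simp: op_spectrum_def is_limit_op_def)

lemma op_spectrum_L: "B \<in> op_spectrum smul P V A \<Longrightarrow> B \<in> L_ops smul"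
  by (elim op_spectrumE) (simp add: P_conv_def)

text \<open>
  Translating \<open>h\<close> by \<open>k\<close> conjugates the approximants with \<open>V\<^sub>k\<close>. Of the two conjugating shifts, the one
  next to the test operator is absorbed into it, and the outer one is an isometry.
\<close>

lemma op_spectrum_shift:
  assumes "B \<in> op_spectrum smul P V A"
  shows "V (- k) \<circ> B \<circ> V k \<in> op_spectrum smul P V A"
proof -
  obtain h where h: "tends_to_infinity h" and conv: "P_conv smul P (\<lambda>n. V (- h n) \<circ> A \<circ> V (h n)) B"
    using assms by (rule op_spectrumE)
  define T where "T n = V (- h n) \<circ> A \<circ> V (h n)" for n
  define D where "D n = (\<lambda>x. T n x - B x)" for n
  have TL: "T n \<in> L_ops smul" and BL: "B \<in> L_ops smul" for n
    using conv by (auto simp: P_conv_def T_def)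
  then have DL: "D n \<in> L_ops smul" for n unfolding D_def by (intro L_ops_diff)
  have shift: "V (- (h n + k)) \<circ> A \<circ> V (h n + k) = V (- k) \<circ> T n \<circ> V k" for n
    using V_add[of "- k" "- h n"] V_add[of "h n" k] by (simp add: T_def comp_assoc[symmetric] add.commute) (simp add: comp_assoc)
  have diff: "(\<lambda>x. (V (- k) \<circ> T n \<circ> V k) x - (V (- k) \<circ> B \<circ> V k) x) = V (- k) \<circ> D n \<circ> V k" for n
    by (simp add: D_def fun_eq_iff linear_diff[OF bounded_linear.linear[OF V_bounded_linear]])
  have "P_conv smul P (\<lambda>n. V (- k) \<circ> T n \<circ> V k) (V (- k) \<circ> B \<circ> V k)"
    unfolding P_conv_def diff
  proof (intro conjI ballI allI)
    fix K assume K: "K \<in> P_compact_ops smul P"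
    have D0: "(\<lambda>n. onorm (D n \<circ> L)) \<longlonglongrightarrow> 0" "(\<lambda>n. onorm (L \<circ> D n)) \<longlonglongrightarrow> 0"
      if "L \<in> P_compact_ops smul P" for L
      using conv that by (auto simp: P_conv_def D_def T_def)
    show "(\<lambda>n. onorm (V (- k) \<circ> D n \<circ> V k \<circ> K)) \<longlonglongrightarrow> 0"
      using D0(1)[OF V_left_P_compact[OF K]] by (simp add: comp_assoc onorm_V_left)
    have KV: "K \<circ> V (- k) \<circ> D n \<in> L_ops smul" for n
      using K by (intro L_ops_compose V_in_L DL) (simp add: P_compact_ops_def)
    show "(\<lambda>n. onorm (K \<circ> (V (- k) \<circ> D n \<circ> V k))) \<longlonglongrightarrow> 0"
    proof (rule tendsto_sandwich[OF _ _ tendsto_const D0(2)[OF V_right_P_compact[OF K]]])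
      show "\<forall>\<^sub>F n in sequentially. 0 \<le> onorm (K \<circ> (V (- k) \<circ> D n \<circ> V k))"
        unfolding comp_assoc[symmetric]
        by (intro always_eventually allI onorm_pos_le L_ops_bounded_linear L_ops_compose[OF KV V_in_L])
      show "\<forall>\<^sub>F n in sequentially. onorm (K \<circ> (V (- k) \<circ> D n \<circ> V k)) \<le> onorm (K \<circ> V (- k) \<circ> D n)"
        unfolding comp_assoc[symmetric]
        by (intro always_eventually allI onorm_V_right_le L_ops_bounded_linear KV)
    qed
  qed (intro L_ops_compose V_in_L TL BL)+
  then have "is_limit_op smul P V A (\<lambda>n. h n + k) (V (- k) \<circ> B \<circ> V k)"
    unfolding is_limit_op_def shift using tends_to_infinity_add[OF h] by blast
  then show ?thesis by (auto simp: op_spectrum_def)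
qed

lemma op_spectrum_id_minus:
  assumes "B \<in> op_spectrum smul P V A"
  shows "(\<lambda>x. x - B x) \<in> op_spectrum smul P V (\<lambda>x. x - A x)"
proof -
  obtain h where h: "tends_to_infinity h" and conv: "P_conv smul P (\<lambda>n. V (- h n) \<circ> A \<circ> V (h n)) B"
    using assms by (rule op_spectrumE)
  define T where "T n = V (- h n) \<circ> A \<circ> V (h n)" for n
  define D where "D n = (\<lambda>x. T n x - B x)" for n
  have TL: "T n \<in> L_ops smul" and BL: "B \<in> L_ops smul" for n
    using conv by (auto simp: P_conv_def T_def)
  have I: "V (- h n) \<circ> (\<lambda>x. x - A x) \<circ> V (h n) = (\<lambda>x. x - T n x)" for n
    by (simp add: T_def fun_eq_iff linear_diff[OF bounded_linear.linear[OF V_bounded_linear]])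
  have diff: "(\<lambda>x. (x - T n x) - (x - B x)) = (\<lambda>x. - D n x)" for n
    by (simp add: D_def fun_eq_iff)
  have "P_conv smul P (\<lambda>n x. x - T n x) (\<lambda>x. x - B x)"
    unfolding P_conv_def diff
  proof (intro conjI ballI allI)
    fix K assume K: "K \<in> P_compact_ops smul P"
    then have "linear K" by (simp add: P_compact_ops_def L_ops_bounded_linear bounded_linear.linear)
    then have "onorm ((\<lambda>x. - D n x) \<circ> K) = onorm (D n \<circ> K)" "onorm (K \<circ> (\<lambda>x. - D n x)) = onorm (K \<circ> D n)" for n
      by (simp_all add: o_def linear_neg onorm_neg)
    then show "(\<lambda>n. onorm ((\<lambda>x. - D n x) \<circ> K)) \<longlonglongrightarrow> 0" "(\<lambda>n. onorm (K \<circ> (\<lambda>x. - D n x))) \<longlonglongrightarrow> 0"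
      using conv K by (simp_all add: P_conv_def D_def T_def)
  qed (intro L_ops_diff id_L_ops TL BL)+
  then have "is_limit_op smul P V (\<lambda>x. x - A x) h (\<lambda>x. x - B x)"
    unfolding is_limit_op_def I using h by blast
  then show ?thesis by (auto simp: op_spectrum_def)
qed

text \<open>
  By locality each coordinate of \<open>V\<^sub>k x\<close> depends on a single coordinate of \<open>x\<close>:
  \<open>P\<^sub>m V\<^sub>k = P\<^sub>m V\<^sub>k P\<^sub>n\<close> for suitable \<open>n\<close>.
\<close>

lemma coord_conv_V:
  assumes "coord_conv P x l"
  shows "coord_conv P (\<lambda>i. V k (x i)) (V k l)"
  unfolding coord_conv_def
proof
  fix m
  obtain n where "\<And>x. P m (V k (Q_op P n x)) = 0" using V_local_all[of m k] by (metis lessI)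
  then have eq: "P m (V k x) = P m (V k (P n x))" for x
    using linear_diff[OF bounded_linear.linear[OF V_bounded_linear]] by (simp add: Q_op_def P_diff)
  have "(\<lambda>i. P m (V k (P n (x i)))) \<longlonglongrightarrow> P m (V k (P n l))"
    using assms[unfolded coord_conv_def, rule_format, of n]
    by (rule bounded_linear.tendsto[OF P_bounded_linear bounded_linear.tendsto[OF V_bounded_linear]])
  then show "(\<lambda>i. P m (V k (x i))) \<longlonglongrightarrow> P m (V k l)" by (simp flip: eq)
qed

text \<open>
  The approximants \<open>T\<^sub>n = V\<^bsub>-h(n)\<^esub> A V\<^bsub>h(n)\<^esub>\<close> inherit sequential continuity from \<open>A \<in> S(Y)\<close>. Each coordinate
  \<open>P\<^sub>m B\<close> is the norm limit of \<open>P\<^sub>m T\<^sub>n\<close>, so on a bounded sequence it is a uniform limit of continuous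
  maps; the usual three-term estimate applies.
\<close>

lemma limit_op_coord_continuous:
  assumes A: "A \<in> S_ops smul P" and B: "B \<in> op_spectrum smul P V A"
    and bdd: "bounded (range x)" and conv: "coord_conv P x l"
  shows "coord_conv P (\<lambda>i. B (x i)) (B l)"
  unfolding coord_conv_def
proof (intro allI LIMSEQ_I)
  fix m and e :: real assume "e > 0"
  obtain h where Pc: "P_conv smul P (\<lambda>n. V (- h n) \<circ> A \<circ> V (h n)) B" using B by (rule op_spectrumE)
  define T where "T n = V (- h n) \<circ> A \<circ> V (h n)" for n
  have TL: "T n \<in> L_ops smul" and BL: "B \<in> L_ops smul" for n
    using Pc by (auto simp: P_conv_def T_def)
  obtain M where M: "M > 0" "\<And>i. norm (x i) \<le> M" using bdd bounded_rangeE by blast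
  define R where "R = M + norm l"
  have R: "R > 0" "norm (x i) \<le> R" "norm l \<le> R" for i
    using M(1) M(2)[of i] by (simp_all add: R_def add_pos_nonneg add_increasing2)
  have "(\<lambda>n. onorm (P m \<circ> (\<lambda>x. T n x - B x))) \<longlonglongrightarrow> 0"
    using P_conv_coord[OF Pc] by (simp add: T_def)
  moreover have "e / (3 * R) > 0" using \<open>e > 0\<close> R(1) by simp
  ultimately have "eventually (\<lambda>n. onorm (P m \<circ> (\<lambda>x. T n x - B x)) < e / (3 * R)) sequentially"
    by (rule order_tendstoD)
  then obtain n where n: "onorm (P m \<circ> (\<lambda>x. T n x - B x)) < e / (3 * R)"
    by (auto simp: eventually_sequentially)
  have close: "norm (P m (T n y) - P m (B y)) \<le> e / 3" if "norm y \<le> R" for y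
  proof -
    have "norm (P m (T n y) - P m (B y)) \<le> e / (3 * R) * R"
      using norm_P_op_diff_le[OF TL BL, of m n y] n that \<open>e > 0\<close> R(1)
      by (elim order_trans) (intro mult_mono, auto)
    then show ?thesis using R(1) by simp
  qed
  have "bounded (range (\<lambda>i. V (h n) (x i)))"
    using M by (auto simp: bounded_iff V_isometry)
  then have "s_conv P (\<lambda>i. A (V (h n) (x i))) (A (V (h n) l))"
    using A bounded_coord_conv_imp_s_conv coord_conv_V[OF conv] by (simp add: S_ops_def)
  from coord_conv_V[OF s_conv_imp_coord_conv[OF this], of "- h n"]
  have "(\<lambda>i. P m (T n (x i))) \<longlonglongrightarrow> P m (T n l)" by (simp add: coord_conv_def T_def)
  then obtain i0 where i0: "\<And>i. i \<ge> i0 \<Longrightarrow> norm (P m (T n (x i)) - P m (T n l)) < e / 3"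
    using LIMSEQ_D[of "\<lambda>i. P m (T n (x i))" _ "e / 3"] \<open>e > 0\<close> by fastforce
  have "norm (P m (B (x i)) - P m (B l)) < e" if "i \<ge> i0" for i
  proof -
    have "P m (B (x i)) - P m (B l) = (P m (T n (x i)) - P m (T n l))
        - (P m (T n (x i)) - P m (B (x i))) + (P m (T n l) - P m (B l))" by simp
    also have "norm \<dots> \<le> norm (P m (T n (x i)) - P m (T n l))
        + norm (P m (T n (x i)) - P m (B (x i))) + norm (P m (T n l) - P m (B l))"
      by (meson norm_triangle_le norm_triangle_ineq4 add_right_mono order_trans norm_triangle_ineq)
    also have "\<dots> < e" using i0[OF that] close[OF R(2)[of i]] close[OF R(3)] by linarith
    finally show ?thesis .
  qed
  then show "\<exists>i0. \<forall>i\<ge>i0. norm (P m (B (x i)) - P m (B l)) < e" by blast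
qed

text \<open>
  Diagonal argument. Choose \<open>g(j) \<in> \<int>\<^sup>N\<close> with \<open>|g(j)| \<ge> j\<close> such that the approximant of \<open>B\<^sub>j\<close> at \<open>g(j)\<close> is within
  \<open>1/(j+1)\<close> of \<open>B\<^sub>j\<close> in the first \<open>j+1\<close> coordinates. Richness yields a limit operator along a subsequence of
  \<open>g\<close>, and the \<open>B\<^sub>j\<close> converge to it because they stay close to the approximants.
\<close>

lemma rich_op_spectrum_seq_compact:
  assumes rich: "rich smul P V A" and B: "\<And>j. B j \<in> op_spectrum smul P V A"
  obtains r C where "strict_mono (r :: nat \<Rightarrow> nat)" "C \<in> op_spectrum smul P V A"
    "\<forall>m. (\<lambda>j. onorm (P m \<circ> (\<lambda>x. B (r j) x - C x))) \<longlonglongrightarrow> 0"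
proof -
  define T where "T k = V (- k) \<circ> A \<circ> V k" for k
  have "\<exists>k. int j \<le> zabs k \<and> T k \<in> L_ops smul \<and>
          (\<forall>m\<le>j. onorm (P m \<circ> (\<lambda>x. T k x - B j x)) < 1 / real (Suc j))" for j
  proof -
    obtain h where h: "tends_to_infinity h" and conv: "P_conv smul P (\<lambda>n. T (h n)) (B j)"
      using B[of j] unfolding T_def by (rule op_spectrumE)
    have "eventually (\<lambda>n. onorm (P m \<circ> (\<lambda>x. T (h n) x - B j x)) < 1 / real (Suc j)) sequentially" for m
      using P_conv_coord[OF conv, of m] by (rule order_tendstoD) simp
    then have "eventually (\<lambda>n. \<forall>m\<in>{..j}. onorm (P m \<circ> (\<lambda>x. T (h n) x - B j x)) < 1 / real (Suc j)) sequentially"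
      by (simp add: eventually_ball_finite_distrib)
    moreover have "eventually (\<lambda>n. int j \<le> zabs (h n)) sequentially"
      using h by (simp add: tends_to_infinity_def filterlim_at_top)
    ultimately have "eventually (\<lambda>n. int j \<le> zabs (h n) \<and>
        (\<forall>m\<in>{..j}. onorm (P m \<circ> (\<lambda>x. T (h n) x - B j x)) < 1 / real (Suc j))) sequentially"
      by eventually_elim simp
    then obtain n where "int j \<le> zabs (h n)" "\<forall>m\<le>j. onorm (P m \<circ> (\<lambda>x. T (h n) x - B j x)) < 1 / real (Suc j)"
      by (auto simp: eventually_sequentially)
    then show ?thesis using conv by (auto simp: P_conv_def)
  qed
  then obtain g where g: "\<And>j. int j \<le> zabs (g j)" "\<And>j. T (g j) \<in> L_ops smul"
    "\<And>j m. m \<le> j \<Longrightarrow> onorm (P m \<circ> (\<lambda>x. T (g j) x - B j x)) < 1 / real (Suc j)"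
    by metis
  have "tends_to_infinity g"
    unfolding tends_to_infinity_def
    by (rule filterlim_at_top_mono[OF filterlim_int_sequentially]) (simp add: g(1))
  then obtain r C where r: "strict_mono r" and lim: "is_limit_op smul P V A (g \<circ> r) C"
    using rich unfolding rich_def by blast
  then have C: "C \<in> op_spectrum smul P V A" and conv: "P_conv smul P (\<lambda>j. T (g (r j))) C"
    by (auto simp: op_spectrum_def is_limit_op_def T_def)
  have CL: "C \<in> L_ops smul" and BL: "B j \<in> L_ops smul" for j
    using B C op_spectrum_L by auto
  have "(\<lambda>j. onorm (P m \<circ> (\<lambda>x. B (r j) x - C x))) \<longlonglongrightarrow> 0" for m
  proof (rule tendsto_sandwich[of "\<lambda>_. 0" _ _ "\<lambda>j. 1 / real (Suc j) + onorm (P m \<circ> (\<lambda>x. T (g (r j)) x - C x))"])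
    show "(\<lambda>j. 1 / real (Suc j) + onorm (P m \<circ> (\<lambda>x. T (g (r j)) x - C x))) \<longlonglongrightarrow> 0"
      using tendsto_add[OF _ P_conv_coord[OF conv, of m], of "\<lambda>j. 1 / real (Suc j)" 0] harmonic_positive_null
      by (simp add: positive_null_def)
    show "\<forall>\<^sub>F j in sequentially. 0 \<le> onorm (P m \<circ> (\<lambda>x. B (r j) x - C x))"
      by (intro always_eventually allI onorm_pos_le L_ops_bounded_linear L_ops_compose P_in_L L_ops_diff BL CL)
    show "\<forall>\<^sub>F j in sequentially. onorm (P m \<circ> (\<lambda>x. B (r j) x - C x))
        \<le> 1 / real (Suc j) + onorm (P m \<circ> (\<lambda>x. T (g (r j)) x - C x))"
      using eventually_ge_at_top[of m]
    proof eventually_elim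
      case (elim j)
      have "m \<le> r j" using elim seq_suble[OF r, of j] by simp
      then have "onorm (P m \<circ> (\<lambda>x. T (g (r j)) x - B (r j) x)) < 1 / real (Suc (r j))"
        by (rule g(3))
      also have "1 / real (Suc (r j)) \<le> 1 / real (Suc j)"
        using seq_suble[OF r, of j] by (intro divide_left_mono) simp_all
      finally have "onorm (P m \<circ> (\<lambda>x. T (g (r j)) x - B (r j) x)) \<le> 1 / real (Suc j)"
        by (rule less_imp_le)
      moreover have "onorm (P m \<circ> (\<lambda>x. B (r j) x - C x))
          \<le> onorm (P m \<circ> (\<lambda>x. T (g (r j)) x - B (r j) x)) + onorm (P m \<circ> (\<lambda>x. T (g (r j)) x - C x))"
      proof (rule onorm_bound)
        show "0 \<le> onorm (P m \<circ> (\<lambda>x. T (g (r j)) x - B (r j) x)) + onorm (P m \<circ> (\<lambda>x. T (g (r j)) x - C x))"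
          by (intro add_nonneg_nonneg onorm_pos_le L_ops_bounded_linear L_ops_compose P_in_L L_ops_diff g(2) BL CL)
        fix x
        have "(P m \<circ> (\<lambda>x. B (r j) x - C x)) x
            = (P m (T (g (r j)) x) - P m (C x)) - (P m (T (g (r j)) x) - P m (B (r j) x))"
          by (simp add: P_diff)
        then show "norm ((P m \<circ> (\<lambda>x. B (r j) x - C x)) x)
          \<le> (onorm (P m \<circ> (\<lambda>x. T (g (r j)) x - B (r j) x)) + onorm (P m \<circ> (\<lambda>x. T (g (r j)) x - C x))) * norm x"
          using norm_P_op_diff_le[OF g(2)[of "r j"] CL, of m x] norm_P_op_diff_le[OF g(2)[of "r j"] BL[of "r j"], of m x]
            norm_triangle_ineq4[of "P m (T (g (r j)) x) - P m (C x)" "P m (T (g (r j)) x) - P m (B (r j) x)"]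
          by (simp add: distrib_right)
      qed
      ultimately show ?case by linarith
    qed
  qed auto
  with r C show thesis using that by blast
qed

section \<open>Uniform lower bounds and invertibility\<close>

lemma coord_conv_of_norm_conv: "x \<longlonglongrightarrow> l \<Longrightarrow> coord_conv P x l"
  unfolding coord_conv_def using bounded_linear.tendsto[OF P_bounded_linear] by blast

text \<open>
  The contradiction argument for the lower bound: a sequence violating it would converge to a
  nonzero vector in the kernel of a limit operator.
\<close>

lemma op_spectrum_bounded_below:
  assumes A: "A \<in> S_ops smul P" and rich: "rich smul P V A" and suff: "sufficient P V"
    and Montel: "uniformly_Montel P (op_spectrum smul P V (\<lambda>x. x - A x))"
    and inj: "\<And>B. B \<in> op_spectrum smul P V A \<Longrightarrow> inj B"
  shows "uniformly_bounded_below (op_spectrum smul P V A)"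
proof (rule ccontr)
  let ?\<sigma> = "op_spectrum smul P V A"
  assume neg: "\<not> ?thesis"
  obtain n where n: "\<And>x. \<exists>k. norm x \<le> 2 * seminorm_n P n (V k x)"
    using suff unfolding sufficient_def by blast
  have "\<exists>C u. C \<in> ?\<sigma> \<and> norm u = 1 \<and> norm (C u) < 1 / real (Suc j) \<and> 1 / 2 \<le> seminorm_n P n u" for j
  proof -
    have "1 / real (Suc j) > 0" by simp
    then obtain B x where B: "B \<in> ?\<sigma>" and x: "norm (B x) < 1 / real (Suc j) * norm x"
      using neg unfolding uniformly_bounded_below_def by (meson not_le)
    have "x \<noteq> 0" using x by auto
    define w where "w = x /\<^sub>R norm x"
    have w: "norm w = 1" using \<open>x \<noteq> 0\<close> by (simp add: w_def)
    have "B w = B x /\<^sub>R norm x"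
      using L_ops_bounded_linear[OF op_spectrum_L[OF B]]
      by (simp add: w_def linear_cmul bounded_linear.linear)
    then have Bw: "norm (B w) < 1 / real (Suc j)"
      using x \<open>x \<noteq> 0\<close> by (simp add: field_simps)
    \<comment> \<open>Shift the vector so that half of its norm is seen by \<open>|\<cdot>|\<^sub>n\<close>, and conjugate \<open>B\<close> accordingly.\<close>
    obtain k where k: "1 \<le> 2 * seminorm_n P n (V k w)" using n[of w] w by auto
    have "V k \<circ> B \<circ> V (- k) \<in> ?\<sigma>" using op_spectrum_shift[OF B, of "- k"] by simp
    moreover have "norm ((V k \<circ> B \<circ> V (- k)) (V k w)) < 1 / real (Suc j)"
      using Bw by (simp add: V_isometry)
    ultimately show ?thesis using k w V_isometry by (intro exI[of _ "V k \<circ> B \<circ> V (- k)"] exI[of _ "V k w"]) auto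
  qed
  then obtain C u where C: "\<And>j. C j \<in> ?\<sigma>" and u: "\<And>j. norm (u j) = 1"
    and Cu: "\<And>j. norm (C j (u j)) < 1 / real (Suc j)" and un: "\<And>j. 1 / 2 \<le> seminorm_n P n (u j)"
    by metis
  obtain r B where r: "strict_mono r" and B: "B \<in> ?\<sigma>"
    and CB: "\<forall>m. (\<lambda>j. onorm (P m \<circ> (\<lambda>x. C (r j) x - B x))) \<longlonglongrightarrow> 0"
    by (rule rich_op_spectrum_seq_compact[where B = C, OF rich C])
  have bdd: "bounded (range (\<lambda>j. u (f j)))" for f :: "nat \<Rightarrow> nat"
    using u by (auto simp: bounded_iff)
  obtain t l where t: "strict_mono t"
    and conv: "coord_conv P ((\<lambda>j. u (r j) - C (r j) (u (r j))) \<circ> t) l"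
    by (rule uniformly_Montel_subseq[where K = "\<lambda>j x. x - C (r j) x" and x = "\<lambda>j. u (r j)",
          OF Montel op_spectrum_id_minus[OF C] bdd])
  have "(\<lambda>j. C j (u j)) \<longlonglongrightarrow> 0"
    using Lim_null_comparison[of "\<lambda>j. C j (u j)" "\<lambda>j. 1 / real (Suc j)" sequentially] Cu harmonic_positive_null
    by (simp add: positive_null_def less_imp_le)
  then have "((\<lambda>j. C j (u j)) \<circ> (r \<circ> t)) \<longlonglongrightarrow> 0"
    using LIMSEQ_subseq_LIMSEQ strict_mono_o[OF r t] by blast
  then have C0: "coord_conv P (\<lambda>j. C (r (t j)) (u (r (t j)))) 0"
    by (intro coord_conv_of_norm_conv) (simp add: o_def)
  have ul: "coord_conv P (\<lambda>j. u (r (t j))) l"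
    unfolding coord_conv_def
  proof
    fix m
    have "(\<lambda>j. P m (u (r (t j)) - C (r (t j)) (u (r (t j)))) + P m (C (r (t j)) (u (r (t j))))) \<longlonglongrightarrow> P m l + P m 0"
      using conv C0 unfolding coord_conv_def by (intro tendsto_add) (simp_all add: o_def)
    then show "(\<lambda>j. P m (u (r (t j)))) \<longlonglongrightarrow> P m l" by (simp flip: P_add)
  qed
  have "coord_conv P (\<lambda>j. C (r (t j)) (u (r (t j)))) (B l)"
  proof (rule coord_conv_op_limit[OF _ _ _ bdd[of "\<lambda>j. r (t j)"]])
    show "coord_conv P (\<lambda>j. B (u (r (t j)))) (B l)"
      by (rule limit_op_coord_continuous[OF A B bdd[of "\<lambda>j. r (t j)"] ul])
    show "(\<lambda>j. onorm (P m \<circ> (\<lambda>x. C (r (t j)) x - B x))) \<longlonglongrightarrow> 0" for m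
      using LIMSEQ_subseq_LIMSEQ[OF CB[rule_format] t] by (simp add: o_def)
  qed (rule op_spectrum_L[OF C] op_spectrum_L[OF B])+
  then have "B l = 0" using C0 coord_conv_unique by blast
  moreover have "B 0 = 0"
    using L_ops_bounded_linear[OF op_spectrum_L[OF B]] by (simp add: linear_0 bounded_linear.linear)
  ultimately have "l = 0" using inj[OF B] by (simp add: inj_def)
  then have "(\<lambda>j. seminorm_n P n (u (r (t j)))) \<longlonglongrightarrow> 0"
    using seminorm_n_coord_conv[OF ul, of n] by simp
  then have "1 / 2 \<le> (0 :: real)"
    by (rule LIMSEQ_le_const) (use un in blast)
  then show False by simp
qed

text \<open>
  A right-hand side \<open>y\<close> is solved by the surjective approximants with bounded solutions, and the Montel
  property makes a subsequence of the solutions converge to a solution for \<open>B\<close>.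
\<close>

lemma surj_of_dense_surj:
  assumes \<B>: "s_dense_in P \<B> (op_spectrum smul P V A)" "\<And>B. B \<in> \<B> \<Longrightarrow> surj B"
    and Montel: "uniformly_Montel P (op_spectrum smul P V (\<lambda>x. x - A x))"
    and below: "uniformly_bounded_below (op_spectrum smul P V A)"
    and B: "B \<in> op_spectrum smul P V A"
  shows "surj B"
  unfolding surj_def
proof
  fix y
  obtain \<nu> where \<nu>: "\<nu> > 0" "\<And>B x. B \<in> op_spectrum smul P V A \<Longrightarrow> \<nu> * norm x \<le> norm (B x)"
    using below unfolding uniformly_bounded_below_def by blast
  obtain C where C: "\<And>n. C n \<in> \<B>" and CB: "op_s_conv P C B"
    using \<B>(1) B unfolding s_dense_in_def by blast
  have C\<sigma>: "C n \<in> op_spectrum smul P V A" for n using C \<B>(1) by (auto simp: s_dense_in_def)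
  have "\<exists>x. C n x = y" for n using \<B>(2)[OF C] by (metis surjD)
  then obtain x where x: "\<And>n. C n (x n) = y" by metis
  have "norm (x n) \<le> norm y / \<nu>" for n
    using \<nu>(2)[OF C\<sigma>, of "x n" n] \<nu>(1) x by (simp add: field_simps)
  then have bdd: "bounded (range x)" by (auto simp: bounded_iff)
  obtain r l where r: "strict_mono r" and conv: "coord_conv P ((\<lambda>n. x n - C n (x n)) \<circ> r) l"
    by (rule uniformly_Montel_subseq[where K = "\<lambda>n x. x - C n x" and x = x,
          OF Montel op_spectrum_id_minus[OF C\<sigma>] bdd])
  define l' where "l' = l + y"
  have xr: "coord_conv P (x \<circ> r) l'"
    unfolding coord_conv_def
  proof
    fix m
    have "(\<lambda>n. P m (x (r n) - y) + P m y) \<longlonglongrightarrow> P m l + P m y"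
      using conv x unfolding coord_conv_def by (intro tendsto_add tendsto_const) (simp add: o_def)
    then show "(\<lambda>n. P m ((x \<circ> r) n)) \<longlonglongrightarrow> P m l'" by (simp add: l'_def flip: P_add)
  qed
  \<comment> \<open>Convergence of \<open>C n\<close> is stated for full sequences, so \<open>x \<circ> r\<close> is spread out
    to a convergent sequence \<open>z\<close> with \<open>z (r n) = x (r n)\<close>, filled up by the limit.\<close>
  define z where "z n = (if n \<in> range r then x n else l')" for n
  have "coord_conv P z l'"
    unfolding coord_conv_def
  proof (intro allI LIMSEQ_I)
    fix m and e :: real assume "e > 0"
    then obtain n0 where n0: "\<And>n. n \<ge> n0 \<Longrightarrow> norm (P m (x (r n)) - P m l') < e"
      using xr LIMSEQ_D unfolding coord_conv_def o_def by blast
    have "norm (P m (z n) - P m l') < e" if "n \<ge> r n0" for n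
      using n0 that \<open>e > 0\<close> r by (auto simp: z_def strict_mono_less_eq)
    then show "\<exists>n0. \<forall>n\<ge>n0. norm (P m (z n) - P m l') < e" by blast
  qed
  moreover have "bounded (range z)"
    by (rule bounded_subset[of "insert l' (range x)"]) (use bdd in \<open>auto simp: z_def\<close>)
  ultimately have "s_conv P (\<lambda>n. C n (z n)) (B l')"
    using CB bounded_coord_conv_imp_s_conv unfolding op_s_conv_def by blast
  then have "coord_conv P ((\<lambda>n. C n (z n)) \<circ> r) (B l')"
    using coord_conv_subseq[OF s_conv_imp_coord_conv r] by blast
  moreover have "(\<lambda>n. C n (z n)) \<circ> r = (\<lambda>_. y)" by (simp add: fun_eq_iff z_def x)
  ultimately have "B l' = y"
    using coord_conv_unique[of "\<lambda>_. y"] by (simp add: coord_conv_def)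
  then show "\<exists>x. y = B x" by blast
qed

end

lemma (in banach_over) bounded_below_surj_invertible:
  assumes B: "B \<in> L_ops smul" and below: "\<nu> > 0" "\<And>x. \<nu> * norm x \<le> norm (B x)" and "surj B"
  shows "invertible_in_L smul B" "onorm (inv B) \<le> 1 / \<nu>"
proof -
  have lin: "linear B" using L_ops_bounded_linear[OF B] by (rule bounded_linear.linear)
  have "inj B"
  proof (rule injI)
    fix x y assume "B x = B y"
    then have "\<nu> * norm (x - y) \<le> 0" using below(2)[of "x - y"] by (simp add: linear_diff[OF lin])
    then show "x = y" using below(1) by (simp add: mult_le_0_iff)
  qed
  have right: "B (inv B y) = y" for y using \<open>surj B\<close> by (rule surj_f_inv_f)
  have left: "inv B (B x) = x" for x using \<open>inj B\<close> by (rule inv_f_f)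
  have bound: "norm (inv B y) \<le> 1 / \<nu> * norm y" for y
    using below(2)[of "inv B y"] below(1) right by (simp add: field_simps)
  have "inv B \<in> L_ops smul"
  proof (rule L_opsI[where C = "1 / \<nu>"])
    show "inv B (x + y) = inv B x + inv B y" for x y
      by (metis L_ops_add[OF B] left right)
    show "inv B (smul c x) = smul c (inv B x)" for c x
      by (metis L_ops_smul[OF B] left right)
    show "norm (inv B x) \<le> norm x * (1 / \<nu>)" for x
      using bound by (simp add: mult.commute)
  qed
  then show "invertible_in_L smul B"
    using B left right unfolding invertible_in_L_def by (auto simp: fun_eq_iff intro!: bexI[of _ "inv B"])
  show "onorm (inv B) \<le> 1 / \<nu>" using below(1) by (intro onorm_bound bound) simp
qed

theorem theorem5p16:
  fixes smul :: "'k::real_normed_field \<Rightarrow> 'a::banach \<Rightarrow> 'a"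
    and P :: "nat \<Rightarrow> 'a \<Rightarrow> 'a"
    and V :: "int ^ 'n \<Rightarrow> 'a \<Rightarrow> 'a"
    and A K :: "'a \<Rightarrow> 'a"
  assumes setting: "isometry_group smul P V"
    and Y_hat: "equals_Y_hat P"
    and A_eq: "A = (\<lambda>x. x - K x)"
    and A_S: "A \<in> S_ops smul P"
    and A_rich: "rich smul P V A"
    and V_suff: "sufficient P V"
    and Montel: "uniformly_Montel P (op_spectrum smul P V K)"
    and inj: "\<forall>B \<in> op_spectrum smul P V A. inj B"
  shows "uniformly_bounded_below (op_spectrum smul P V A) \<and>
         ((\<exists>\<B>. s_dense_in P \<B> (op_spectrum smul P V A) \<and> (\<forall>B\<in>\<B>. surj B)) \<longrightarrow>
           (\<forall>B \<in> op_spectrum smul P V A. invertible_in_L smul B) \<and>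
           (\<exists>C. \<forall>B \<in> op_spectrum smul P V A. onorm (inv B) \<le> C))"
proof -
  interpret isometry_group smul P V by (rule setting)
  have "K = (\<lambda>x. x - A x)" by (simp add: A_eq)
  with Montel have Montel': "uniformly_Montel P (op_spectrum smul P V (\<lambda>x. x - A x))" by simp
  have below: "uniformly_bounded_below (op_spectrum smul P V A)"
    using op_spectrum_bounded_below[OF A_S A_rich V_suff Montel'] inj by blast
  then obtain \<nu> where \<nu>: "\<nu> > 0" "\<And>B x. B \<in> op_spectrum smul P V A \<Longrightarrow> \<nu> * norm x \<le> norm (B x)"
    unfolding uniformly_bounded_below_def by blast
  have "invertible_in_L smul B \<and> onorm (inv B) \<le> 1 / \<nu>"
    if "s_dense_in P \<B> (op_spectrum smul P V A)" "\<forall>B\<in>\<B>. surj B" "B \<in> op_spectrum smul P V A" for \<B> B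
    using bounded_below_surj_invertible[OF op_spectrum_L[OF that(3)] \<nu>(1) \<nu>(2)[OF that(3)]]
      surj_of_dense_surj[OF that(1) _ Montel' below that(3)] that(2) by blast
  with below show ?thesis by blast
qed

end
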